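(* Let $\omega\colon G\times B\to\mathrm{Hom}(E,F)$ be a filter and let $\kappa$ be the kernel obtained from $\omega$ by $$\kappa(k.b,b)(v):=\int_{G_b}\omega(kh,b)\big(h^{-1}k^{-1}.v\big)\,d\nu_b(h)\qquad(b\in B,\ k\in G,\ v\in E_{k.b}).$$ Then for any continuous section $f\in\Gamma(E)$ and any $b\in B$ we have $$T_\kappa(f)(b)=(\omega\star\tilde f)(e,b),$$ where $\tilde f\colon G\times B\to E$, $(h,b)\mapsto h^{-1}.f(h.b)$ is the Mackey section associated to $f$.
   Context: $G$ is a Hausdorff topological group with neutral element $e$, and $B$ is a Hausdorff topological space with a continuous left action $(g,b)\mapsto g.b$; $G_b$ is the stabilizer and $G.b\subseteq B$ the orbit of $b$ (subspace topologies). A $G$-equivariant real vector bundle $E\to B$ is a (finite-rank, locally trivial) real vector bundle with a continuous left $G$-action on $E$ such that the projection is $G$-equivariant and each $g\in G$ maps the fiber $E_b$ linearly to $E_{g.b}$. Let $E\to B$ and $F\to B$ be $G$-equivariant real vector bundles; $\Gamma(E)$ denotes continuous sections. Measures: We have three families of locally finite Borel measures $\{\mu_b\colon\mathcal B(G)\to[0,\infty]\}_{b\in B}$, $\{\bar\mu_b\colon\mathcal B(G.b)\to[0,\infty]\}_{b\in B}$, and $\{\nu_b\colon\mathcal B(G_b)\to[0,\infty]\}_{b\in B}$, each $\nu_b$ left-invariant, such that for all $g\in G$, $b\in B$: $\mu_{g.b}=c_{g*}\mu_b$, $\nu_{g.b}=c_{g*}\nu_b$ (pushforwards along the conjugations $c_g\colon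 G\to G$ resp. $c_g\colon G_b\to G_{g.b}$, $h\mapsto ghg^{-1}$), and $\bar\mu_{g.b}=(g.\_)_*\bar\mu_b$ (pushforward along $c\mapsto g.c$). The family $\{\mu_b\}$ is continuous: $b\mapsto\int_G f'\,d\mu_b$ is continuous for every compactly supported continuous $f'\colon G\to\mathbb R$. Moreover, for all $b\in B$ and compactly supported continuous $f'\colon G\to\mathbb R$, $$\int_G f'(h)\,d\mu_b(h)=\int_{G.b}\int_{G_b}f'(kh)\,d\nu_b(h)\,d\bar\mu_b(k.b),$$ where for a point $c\in G.b$ of the outer integration $k$ is any element of $G$ with $k.b=c$ (the inner integral does not depend on the choice, by left-invariance of $\nu_b$). Filter: $\mathrm{Hom}(E,F)\to B$ is the bundle with fiber $\mathrm{Hom}(E_b,F_b)$ over $b$. A filter is a continuous map $\omega\colon G\times B\to\mathrm{Hom}(E,F)$ with $\omega(h,b)\in\mathrm{Hom}(E_b,F_b)$ such that $\omega(-,b)$ has compact support for each $b\in B$ and $\omega(ghg^{-1},g.b)(g.v)=g.\omega(h,b)(v)$ for all $g,h\in G$, $b\in B$, $v\in E_b$. The cross-correlation is $(\omega\star\tilde f)(h,b):=\int_G\omega(k,b)(\tilde f(hk,b))\,d\mu_b(k)$. Kernel: $\kappa(c,b)\in\mathrm{Hom}(E_c,F_b)$ for $b\in B$, $c\in G.b$; the formula in the claim is independent of the choice of $k$ with $k.b=c$ since $\nu_b$ is left-invariant. The orbitwise integral transform is $T_\kappa(f)(b):=\int_{G.b}\kappa(c,b)(f(c))\,d\bar\mu_b(c)$.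 *)

theory Defs
  imports "HOL-Analysis.Analysis"
begin

(* A topological group is a type of the library class topological_group_add, which does not assume
   commutativity.  Hence the group is written additively: g + h is the product gh, - g is the
   inverse, 0 is the neutral element and g + h - g is the conjugate ghg^{-1}. *)

definition continuous_action ::
    "('g::topological_group_add \<Rightarrow> 'x::topological_space \<Rightarrow> 'x) \<Rightarrow> bool" where
  "continuous_action act \<longleftrightarrow>
     (\<forall>x. act 0 x = x) \<and>
     (\<forall>g h x. act (g + h) x = act g (act h x)) \<and>
     continuous_on UNIV (\<lambda>(g, x). act g x)"

definition stab :: "('g \<Rightarrow> 'x \<Rightarrow> 'x) \<Rightarrow> 'x \<Rightarrow> 'g set" where
  "stab act x = {g. act g x = x}"

definition orbit :: "('g \<Rightarrow> 'x \<Rightarrow> 'x) \<Rightarrow> 'x \<Rightarrow> 'x set" where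
  "orbit act x = range (\<lambda>g. act g x)"

(* Some k with k.x = y, for y in the orbit of x.  Everything below that uses it is independent of
   the choice: see inner_integral_transporter and orbit_kernel_apply. *)
definition transporter :: "('g \<Rightarrow> 'x \<Rightarrow> 'x) \<Rightarrow> 'x \<Rightarrow> 'x \<Rightarrow> 'g" where
  "transporter act x y = (SOME k. act k x = y)"

record 'a vs =
  vcarrier :: "'a set"
  vadd :: "'a \<Rightarrow> 'a \<Rightarrow> 'a"
  vzero :: 'a
  vscale :: "real \<Rightarrow> 'a \<Rightarrow> 'a"

definition real_vector_space :: "'a vs \<Rightarrow> bool" where
  "real_vector_space V \<longleftrightarrow>
     vzero V \<in> vcarrier V \<and>
     (\<forall>x\<in>vcarrier V. \<forall>y\<in>vcarrier V. vadd V x y \<in> vcarrier V) \<and>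
     (\<forall>a. \<forall>x\<in>vcarrier V. vscale V a x \<in> vcarrier V) \<and>
     (\<forall>x\<in>vcarrier V. \<forall>y\<in>vcarrier V. \<forall>z\<in>vcarrier V.
        vadd V (vadd V x y) z = vadd V x (vadd V y z)) \<and>
     (\<forall>x\<in>vcarrier V. \<forall>y\<in>vcarrier V. vadd V x y = vadd V y x) \<and>
     (\<forall>x\<in>vcarrier V. vadd V (vzero V) x = x) \<and>
     (\<forall>x\<in>vcarrier V. \<exists>y\<in>vcarrier V. vadd V x y = vzero V) \<and>
     (\<forall>a. \<forall>x\<in>vcarrier V. \<forall>y\<in>vcarrier V.
        vscale V a (vadd V x y) = vadd V (vscale V a x) (vscale V a y)) \<and>
     (\<forall>a b. \<forall>x\<in>vcarrier V. vscale V (a + b) x = vadd V (vscale V a x) (vscale V b x)) \<and>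
     (\<forall>a b. \<forall>x\<in>vcarrier V. vscale V (a * b) x = vscale V a (vscale V b x)) \<and>
     (\<forall>x\<in>vcarrier V. vscale V 1 x = x)"

definition linear_map :: "'a vs \<Rightarrow> 'c vs \<Rightarrow> ('a \<Rightarrow> 'c) \<Rightarrow> bool" where
  "linear_map V W T \<longleftrightarrow>
     (\<forall>x\<in>vcarrier V. T x \<in> vcarrier W) \<and>
     (\<forall>x\<in>vcarrier V. \<forall>y\<in>vcarrier V. T (vadd V x y) = vadd W (T x) (T y)) \<and>
     (\<forall>a. \<forall>x\<in>vcarrier V. T (vscale V a x) = vscale W a (T x))"

definition scalars :: "real vs" where
  "scalars = \<lparr>vcarrier = UNIV, vadd = (+), vzero = 0, vscale = (*)\<rparr>"

definition coord_space :: "nat \<Rightarrow> (nat \<Rightarrow> real) vs" where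
  "coord_space n =
     \<lparr>vcarrier = topspace (Euclidean_space n), vadd = (\<lambda>x y i. x i + y i),
      vzero = (\<lambda>i. 0), vscale = (\<lambda>a x i. a * x i)\<rparr>"

definition unit_vec :: "nat \<Rightarrow> nat \<Rightarrow> real" where
  "unit_vec j = (\<lambda>i. if i = j then 1 else 0)"

(* Integrals with values in a finite-dimensional real vector space V, tested against its dual:
   w is the integral of f if l(w) is the integral of l o f for every linear functional l on V. *)
definition has_vs_integral ::
    "'a vs \<Rightarrow> 'm measure \<Rightarrow> ('m \<Rightarrow> 'a) \<Rightarrow> 'a \<Rightarrow> bool" where
  "has_vs_integral V M f w \<longleftrightarrow>
     w \<in> vcarrier V \<and> (\<forall>x\<in>space M. f x \<in> vcarrier V) \<and>
     (\<forall>l. linear_map V scalars l \<longrightarrow> has_bochner_integral M (\<lambda>x. l (f x)) (l w))"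

definition vs_integrable :: "'a vs \<Rightarrow> 'm measure \<Rightarrow> ('m \<Rightarrow> 'a) \<Rightarrow> bool" where
  "vs_integrable V M f \<longleftrightarrow> (\<exists>w. has_vs_integral V M f w)"

definition vs_integral :: "'a vs \<Rightarrow> 'm measure \<Rightarrow> ('m \<Rightarrow> 'a) \<Rightarrow> 'a" where
  "vs_integral V M f = (THE w. has_vs_integral V M f w)"

(* The type 'e is the total space.  badd is meaningful only for two points of the same fiber. *)
record ('b, 'e) vbundle =
  proj :: "'e \<Rightarrow> 'b"
  badd :: "'e \<Rightarrow> 'e \<Rightarrow> 'e"
  bzero :: "'b \<Rightarrow> 'e"
  bscale :: "real \<Rightarrow> 'e \<Rightarrow> 'e"

definition fiber :: "('b, 'e) vbundle \<Rightarrow> 'b \<Rightarrow> 'e vs" where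
  "fiber E b =
     \<lparr>vcarrier = proj E -` {b}, vadd = badd E, vzero = bzero E b, vscale = bscale E\<rparr>"

definition local_trivialization ::
    "('b::topological_space, 'e::topological_space) vbundle \<Rightarrow>
     'b set \<Rightarrow> nat \<Rightarrow> ('e \<Rightarrow> 'b \<times> (nat \<Rightarrow> real)) \<Rightarrow> bool" where
  "local_trivialization E U n \<phi> \<longleftrightarrow>
     open U \<and>
     homeomorphic_map (top_of_set (proj E -` U))
       (prod_topology (top_of_set U) (Euclidean_space n)) \<phi> \<and>
     (\<forall>v\<in>proj E -` U. fst (\<phi> v) = proj E v) \<and>
     (\<forall>b\<in>U. linear_map (fiber E b) (coord_space n) (\<lambda>v. snd (\<phi> v)))"

definition vector_bundle ::
    "('b::topological_space, 'e::topological_space) vbundle \<Rightarrow> bool" where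
  "vector_bundle E \<longleftrightarrow>
     continuous_on UNIV (proj E) \<and>
     (\<forall>b. real_vector_space (fiber E b)) \<and>
     (\<forall>b. \<exists>U n \<phi>. b \<in> U \<and> local_trivialization E U n \<phi>)"

definition equivariant_bundle ::
    "('g::topological_group_add \<Rightarrow> 'b::topological_space \<Rightarrow> 'b) \<Rightarrow>
     ('b, 'e::topological_space) vbundle \<Rightarrow> ('g \<Rightarrow> 'e \<Rightarrow> 'e) \<Rightarrow> bool" where
  "equivariant_bundle act E actE \<longleftrightarrow>
     vector_bundle E \<and> continuous_action actE \<and>
     (\<forall>g v. proj E (actE g v) = act g (proj E v)) \<and>
     (\<forall>g b. linear_map (fiber E b) (fiber E (act g b)) (actE g))"

definition continuous_section ::
    "('b::topological_space, 'e::topological_space) vbundle \<Rightarrow> ('b \<Rightarrow> 'e) \<Rightarrow> bool" where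
  "continuous_section E f \<longleftrightarrow> continuous_on UNIV f \<and> (\<forall>b. proj E (f b) = b)"

(* A point of Hom(E,F) over b is a pair (b, T); T is extensional, so that it is determined by its values on the
   fiber over b. *)
definition hom_total :: "('b, 'e) vbundle \<Rightarrow> ('b, 'f) vbundle \<Rightarrow> ('b \<times> ('e \<Rightarrow> 'f)) set" where
  "hom_total E F =
     {(b, T). linear_map (fiber E b) (fiber F b) T \<and> T \<in> extensional (proj E -` {b})}"

(* Trivializations of E and F over U identify Hom(E_b,F_b) with the linear maps R^n \<rightarrow> R^m,
   which are given by their n columns in R^m. *)
definition hom_chart ::
    "('b, 'e) vbundle \<Rightarrow> 'b set \<Rightarrow> nat \<Rightarrow> ('e \<Rightarrow> 'b \<times> (nat \<Rightarrow> real)) \<Rightarrow>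
     ('f \<Rightarrow> 'b \<times> (nat \<Rightarrow> real)) \<Rightarrow> 'b \<times> ('e \<Rightarrow> 'f) \<Rightarrow> 'b \<times> (nat \<Rightarrow> nat \<Rightarrow> real)" where
  "hom_chart E U n \<phi> \<psi> = (\<lambda>(b, T).
     (b, \<lambda>j\<in>{..<n}. snd (\<psi> (T (inv_into (proj E -` U) \<phi> (b, unit_vec j))))))"

definition hom_topology ::
    "('b::topological_space, 'e::topological_space) vbundle \<Rightarrow>
     ('b, 'f::topological_space) vbundle \<Rightarrow> ('b \<times> ('e \<Rightarrow> 'f)) topology" where
  "hom_topology E F = topology_generated_by
     {{x \<in> hom_total E F. fst x \<in> U \<and> hom_chart E U n \<phi> \<psi> x \<in> W} | U n m \<phi> \<psi> W.
        local_trivialization E U n \<phi> \<and> local_trivialization F U m \<psi> \<and>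
        openin (prod_topology (top_of_set U)
                  (product_topology (\<lambda>_. Euclidean_space m) {..<n})) W}"

(* The Borel sets of the subspace S are the traces of the Borel sets of the ambient space. *)
definition locally_finite_borel_on ::
    "'x::topological_space set \<Rightarrow> 'x measure \<Rightarrow> bool" where
  "locally_finite_borel_on S M \<longleftrightarrow>
     sets M = sets (restrict_space borel S) \<and>
     (\<forall>x\<in>S. \<exists>U. open U \<and> x \<in> U \<and> emeasure M (U \<inter> S) < \<infinity>)"

definition compactly_supported :: "('x::topological_space \<Rightarrow> real) \<Rightarrow> bool" where
  "compactly_supported f \<longleftrightarrow> compact (closure {x. f x \<noteq> 0})"

(* mub b is the measure on the orbit of b.  The last conjunct says that the iterated integral
   exists and equals the integral over the group. *)
definition orbit_measures ::
    "('g::topological_group_add \<Rightarrow> 'b::topological_space \<Rightarrow> 'b) \<Rightarrow>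
     ('b \<Rightarrow> 'g measure) \<Rightarrow> ('b \<Rightarrow> 'b measure) \<Rightarrow> ('b \<Rightarrow> 'g measure) \<Rightarrow> bool" where
  "orbit_measures act mu mub nu \<longleftrightarrow>
     (\<forall>b. locally_finite_borel_on UNIV (mu b)) \<and>
     (\<forall>b. locally_finite_borel_on (orbit act b) (mub b)) \<and>
     (\<forall>b. locally_finite_borel_on (stab act b) (nu b)) \<and>
     (\<forall>b. \<forall>g\<in>stab act b. distr (nu b) (nu b) (\<lambda>h. g + h) = nu b) \<and>
     (\<forall>g b. mu (act g b) = distr (mu b) borel (\<lambda>h. g + h - g)) \<and>
     (\<forall>g b. nu (act g b) =
        distr (nu b) (restrict_space borel (stab act (act g b))) (\<lambda>h. g + h - g)) \<and>
     (\<forall>g b. mub (act g b) = distr (mub b) (restrict_space borel (orbit act b)) (act g)) \<and>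
     (\<forall>f. continuous_on UNIV f \<and> compactly_supported f \<longrightarrow>
        continuous_on UNIV (\<lambda>b. \<integral>h. f h \<partial>mu b)) \<and>
     (\<forall>b f. continuous_on UNIV f \<and> compactly_supported f \<longrightarrow>
        has_bochner_integral (mub b)
          (\<lambda>c. \<integral>h. f (transporter act b c + h) \<partial>nu b) (\<integral>h. f h \<partial>mu b))"

definition equivariant_filter ::
    "('g::topological_group_add \<Rightarrow> 'b::topological_space \<Rightarrow> 'b) \<Rightarrow>
     ('b, 'e::topological_space) vbundle \<Rightarrow> ('g \<Rightarrow> 'e \<Rightarrow> 'e) \<Rightarrow>
     ('b, 'f::topological_space) vbundle \<Rightarrow> ('g \<Rightarrow> 'f \<Rightarrow> 'f) \<Rightarrow>
     ('g \<Rightarrow> 'b \<Rightarrow> 'e \<Rightarrow> 'f) \<Rightarrow> bool" where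
  "equivariant_filter act E actE F actF \<omega> \<longleftrightarrow>
     (\<forall>h b. (b, \<omega> h b) \<in> hom_total E F) \<and>
     continuous_map euclidean (hom_topology E F) (\<lambda>(h, b). (b, \<omega> h b)) \<and>
     (\<forall>b. compact (closure {h. \<exists>v\<in>proj E -` {b}. \<omega> h b v \<noteq> bzero F b})) \<and>
     (\<forall>g h b. \<forall>v\<in>proj E -` {b}.
        \<omega> (g + h - g) (act g b) (actE g v) = actF g (\<omega> h b v))"

definition mackey_section ::
    "('g::group_add \<Rightarrow> 'b \<Rightarrow> 'b) \<Rightarrow> ('g \<Rightarrow> 'e \<Rightarrow> 'e) \<Rightarrow> ('b \<Rightarrow> 'e) \<Rightarrow> 'g \<Rightarrow> 'b \<Rightarrow> 'e" where
  "mackey_section act actE f h b = actE (- h) (f (act h b))"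

definition cross_correlation ::
    "('b, 'f) vbundle \<Rightarrow> ('b \<Rightarrow> 'g::group_add measure) \<Rightarrow> ('g \<Rightarrow> 'b \<Rightarrow> 'e \<Rightarrow> 'f) \<Rightarrow>
     ('g \<Rightarrow> 'b \<Rightarrow> 'e) \<Rightarrow> 'g \<Rightarrow> 'b \<Rightarrow> 'f" where
  "cross_correlation F mu \<omega> s h b =
     vs_integral (fiber F b) (mu b) (\<lambda>k. \<omega> k b (s (h + k) b))"

definition orbit_kernel ::
    "('g::group_add \<Rightarrow> 'b \<Rightarrow> 'b) \<Rightarrow> ('g \<Rightarrow> 'e \<Rightarrow> 'e) \<Rightarrow> ('b, 'f) vbundle \<Rightarrow>
     ('b \<Rightarrow> 'g measure) \<Rightarrow> ('g \<Rightarrow> 'b \<Rightarrow> 'e \<Rightarrow> 'f) \<Rightarrow> 'b \<Rightarrow> 'b \<Rightarrow> 'e \<Rightarrow> 'f" where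
  "orbit_kernel act actE F nu \<omega> c b v =
     (let k = transporter act b c in
      vs_integral (fiber F b) (nu b) (\<lambda>h. \<omega> (k + h) b (actE (- h + - k) v)))"

definition orbit_transform ::
    "('b, 'f) vbundle \<Rightarrow> ('b \<Rightarrow> 'b measure) \<Rightarrow> ('b \<Rightarrow> 'b \<Rightarrow> 'e \<Rightarrow> 'f) \<Rightarrow>
     ('b \<Rightarrow> 'e) \<Rightarrow> 'b \<Rightarrow> 'f" where
  "orbit_transform F mub \<kappa> f b =
     vs_integral (fiber F b) (mub b) (\<lambda>c. \<kappa> c b (f c))"

lemma act_transporter: "act (transporter act b (act k b)) b = act k b"
  unfolding transporter_def by (rule someI_ex) auto

lemma transporter_decomp:
  fixes act :: "'g::topological_group_add \<Rightarrow> 'b::topological_space \<Rightarrow> 'b"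
  assumes "continuous_action act"
  obtains g where "g \<in> stab act b" "transporter act b (act k b) = k + g"
proof
  let ?t = "transporter act b (act k b)"
  have "act (- k + ?t) b = act (- k) (act k b)"
    using assms by (simp add: continuous_action_def act_transporter)
  also have "\<dots> = act (- k + k) b"
    using assms by (simp add: continuous_action_def del: add.left_inverse left_minus)
  finally show "- k + ?t \<in> stab act b"
    using assms by (simp add: continuous_action_def stab_def)
  show "?t = k + (- k + ?t)"
    by (simp flip: add.assoc)
qed

lemma stab_add:
  fixes act :: "'g::topological_group_add \<Rightarrow> 'b::topological_space \<Rightarrow> 'b"
  assumes "continuous_action act" "g \<in> stab act b" "h \<in> stab act b"
  shows "g + h \<in> stab act b"
  using assms by (simp add: continuous_action_def stab_def)

lemma stab_minus:
  fixes act :: "'g::topological_group_add \<Rightarrow> 'b::topological_space \<Rightarrow> 'b"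
  assumes "continuous_action act" "g \<in> stab act b"
  shows "- g \<in> stab act b"
proof -
  have gb: "act g b = b"
    using assms(2) by (simp add: stab_def)
  have "act (- g + g) b = act (- g) (act g b)"
    using assms(1) unfolding continuous_action_def by blast
  then have "act (- g) b = act 0 b"
    by (simp only: gb left_minus)
  then show ?thesis
    using assms(1) by (simp add: continuous_action_def stab_def)
qed

lemma measurable_translation_stab:
  fixes act :: "'g::topological_group_add \<Rightarrow> 'b::topological_space \<Rightarrow> 'b"
  assumes "continuous_action act" "orbit_measures act mu mub nu" "g \<in> stab act b"
  shows "(\<lambda>h. g + h) \<in> measurable (nu b) (nu b)"
proof -
  have s: "sets (nu b) = sets (restrict_space borel (stab act b))"
    using assms(2) by (simp add: orbit_measures_def locally_finite_borel_on_def)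
  have "(\<lambda>h. g + h) \<in> measurable borel borel"
    by (intro borel_measurable_continuous_onI continuous_intros)
  then have "(\<lambda>h. g + h) \<in>
      measurable (restrict_space borel (stab act b)) (restrict_space borel (stab act b))"
    by (intro measurable_restrict_space3) (auto intro: stab_add[OF assms(1,3)])
  then show ?thesis
    using measurable_cong_sets[OF s s] by simp
qed

lemma has_bochner_integral_translation_iff:
  fixes act :: "'g::topological_group_add \<Rightarrow> 'b::topological_space \<Rightarrow> 'b"
    and f :: "'g \<Rightarrow> real"
  assumes act: "continuous_action act" and meas: "orbit_measures act mu mub nu"
    and g: "g \<in> stab act b"
  shows "has_bochner_integral (nu b) (\<lambda>h. f (g + h)) w \<longleftrightarrow> has_bochner_integral (nu b) f w"
proof -
  have *: "has_bochner_integral (nu b) (\<lambda>h. f (g + h)) w"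
    if f: "has_bochner_integral (nu b) f w" and g: "g \<in> stab act b" for f :: "'g \<Rightarrow> real" and g
  proof -
    have T: "(\<lambda>h. g + h) \<in> measurable (nu b) (nu b)"
      by (rule measurable_translation_stab[OF act meas g])
    have "distr (nu b) (nu b) (\<lambda>h. g + h) = nu b"
      using meas g by (simp add: orbit_measures_def)
    then have "has_bochner_integral (distr (nu b) (nu b) (\<lambda>h. g + h)) f w"
      using f by simp
    then show ?thesis
      using f by (simp add: has_bochner_integral_iff integrable_distr_eq[OF T] integral_distr[OF T]
          borel_measurable_integrable)
  qed
  show ?thesis
    using *[of f g] *[of "\<lambda>h. f (g + h)" "- g"] g stab_minus[OF act g]
    by (auto simp flip: add.assoc)
qed

lemma inner_integral_transporter:
  fixes act :: "'g::topological_group_add \<Rightarrow> 'b::topological_space \<Rightarrow> 'b"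
    and f :: "'g \<Rightarrow> real"
  assumes "continuous_action act" "orbit_measures act mu mub nu"
  shows "(\<integral>h. f (transporter act b (act k b) + h) \<partial>nu b) = (\<integral>h. f (k + h) \<partial>nu b)"
proof -
  obtain g where g: "g \<in> stab act b" "transporter act b (act k b) = k + g"
    by (rule transporter_decomp[OF assms(1)])
  have *: "has_bochner_integral (nu b) (\<lambda>h. f (k + (g + h))) w \<longleftrightarrow>
        has_bochner_integral (nu b) (\<lambda>h. f (k + h)) w" for w
    by (rule has_bochner_integral_translation_iff[OF assms g(1)])
  have "(\<integral>h. f (k + (g + h)) \<partial>nu b) = (\<integral>h. f (k + h) \<partial>nu b)"
    unfolding lebesgue_integral_def * ..
  then show ?thesis
    by (simp only: g(2) add.assoc)
qed

lemma orbit_kernel_apply: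
  fixes act :: "'g::topological_group_add \<Rightarrow> 'b::topological_space \<Rightarrow> 'b"
  assumes "continuous_action act" "orbit_measures act mu mub nu"
  shows "orbit_kernel act actE F nu \<omega> (act k b) b v =
    vs_integral (fiber F b) (nu b) (\<lambda>h. \<omega> (k + h) b (actE (- h + - k) v))"
proof -
  obtain g where g: "g \<in> stab act b" "transporter act b (act k b) = k + g"
    by (rule transporter_decomp[OF assms(1)])
  define \<Phi> where "\<Phi> h = \<omega> (k + h) b (actE (- h + - k) v)" for h
  have sp: "space (nu b) = stab act b"
    using assms(2) sets_eq_imp_space_eq[of "nu b" "restrict_space borel (stab act b)"]
    by (simp add: orbit_measures_def locally_finite_borel_on_def space_restrict_space)
  have "(\<forall>h\<in>stab act b. \<Phi> (g + h) \<in> V) \<longleftrightarrow> (\<forall>h\<in>stab act b. \<Phi> h \<in> V)" for V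
  proof safe
    fix h assume a: "\<forall>h\<in>stab act b. \<Phi> (g + h) \<in> V" and h: "h \<in> stab act b"
    have "\<Phi> (g + (- g + h)) \<in> V"
      using a stab_add[OF assms(1) stab_minus[OF assms(1) g(1)] h] by blast
    then show "\<Phi> h \<in> V" by (simp flip: add.assoc)
  qed (use stab_add[OF assms(1) g(1)] in blast)
  moreover have "has_bochner_integral (nu b) (\<lambda>h. l (\<Phi> (g + h))) x \<longleftrightarrow>
      has_bochner_integral (nu b) (\<lambda>h. l (\<Phi> h)) x" for l :: "_ \<Rightarrow> real" and x
    by (rule has_bochner_integral_translation_iff[OF assms g(1)])
  ultimately have "has_vs_integral (fiber F b) (nu b) (\<lambda>h. \<Phi> (g + h)) w \<longleftrightarrow>
      has_vs_integral (fiber F b) (nu b) \<Phi> w" for w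
    unfolding has_vs_integral_def sp by presburger
  then have "vs_integral (fiber F b) (nu b) (\<lambda>h. \<Phi> (g + h)) = vs_integral (fiber F b) (nu b) \<Phi>"
    by (simp add: vs_integral_def)
  moreover have "\<omega> (k + g + h) b (actE (- h + - (k + g)) v) = \<Phi> (g + h)" for h
  proof -
    have "- h + - (k + g) = - (g + h) + - k"
      by (simp add: diff_conv_add_uminus minus_add add.assoc del: add_uminus_conv_diff)
    then show ?thesis
      by (simp only: \<Phi>_def add.assoc)
  qed
  ultimately have "orbit_kernel act actE F nu \<omega> (act k b) b v = vs_integral (fiber F b) (nu b) \<Phi>"
    by (simp only: orbit_kernel_def g(2) Let_def)
  then show ?thesis
    by (simp only: \<Phi>_def[abs_def])
qed

end

theory Submission
  imports Defs
begin

text \<open>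
  For fixed \<open>b\<close> put \<open>\<Phi> k = \<omega> k b (k\<^sup>-\<^sup>1 . f (k . b))\<close>, a compactly supported continuous map from the
  group to the fiber \<open>F\<^sub>b\<close>. Since \<open>(k h) . b = k . b\<close> for \<open>h\<close> in the stabilizer, the kernel applied
  to \<open>f\<close> at \<open>k . b\<close> is the integral of \<open>\<Phi> (k h)\<close> over the stabilizer. Both sides of the claim are
  therefore integrals of \<open>\<Phi>\<close>, and after pairing with linear functionals on \<open>F\<^sub>b\<close> they agree by the
  assumed decomposition of the measure on the group. Continuity of these pairings is read off the
  matrix entries of \<open>\<omega>\<close> in local trivializations.
\<close>

section \<open>Finite-dimensional vector spaces\<close>

lemma vcarrier_coord_space: "x \<in> vcarrier (coord_space n) \<longleftrightarrow> (\<forall>i\<ge>n. x i = 0)"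
  by (simp add: coord_space_def topspace_Euclidean_space)

lemma unit_vec_in_coord_space: "j < n \<Longrightarrow> unit_vec j \<in> vcarrier (coord_space n)"
  by (simp add: vcarrier_coord_space unit_vec_def)

text \<open>Induction on a bound \<open>m\<close> for the support of \<open>x\<close>: clearing
  coordinate \<open>m\<close> leaves a vector supported below \<open>m\<close>, and the part removed
  is a multiple of \<open>unit_vec m\<close>.\<close>

lemma linear_functional_coord_space:
  assumes L: "linear_map (coord_space n) scalars L" and x: "x \<in> vcarrier (coord_space n)"
  shows "L x = (\<Sum>j<n. x j * L (unit_vec j))"
proof -
  have add: "L (\<lambda>i. x i + y i) = L x + L y"
    if "x \<in> vcarrier (coord_space n)" "y \<in> vcarrier (coord_space n)" for x y
    using L that by (auto simp: linear_map_def scalars_def coord_space_def)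
  have scale: "L (\<lambda>i. a * x i) = a * L x" if "x \<in> vcarrier (coord_space n)" for a x
    using L that by (auto simp: linear_map_def scalars_def coord_space_def)
  have "L x = (\<Sum>j<m. x j * L (unit_vec j))" if "m \<le> n" "\<forall>i\<ge>m. x i = 0" for m x
    using that
  proof (induction m arbitrary: x)
    case 0
    \<comment> \<open>The zero vector is written as a multiple of itself, so that homogeneity gives
      \<open>L x = 0\<close>.\<close>
    then have "x = (\<lambda>i. 0 * x i)" by auto
    moreover have "x \<in> vcarrier (coord_space n)" using 0 by (simp add: vcarrier_coord_space)
    ultimately show ?case using scale[of x 0] by simp
  next
    case (Suc m)
    define y where "y = x(m := 0)"
    have x_eq: "x = (\<lambda>i. y i + x m * unit_vec m i)"
      by (auto simp: y_def unit_vec_def)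
    have y: "y \<in> vcarrier (coord_space n)"
      using Suc.prems by (simp add: vcarrier_coord_space y_def)
    have e: "(\<lambda>i. x m * unit_vec m i) \<in> vcarrier (coord_space n)"
      using Suc.prems by (simp add: vcarrier_coord_space unit_vec_def)
    have "L x = L (\<lambda>i. y i + x m * unit_vec m i)" using x_eq by (rule arg_cong)
    also have "\<dots> = L y + x m * L (unit_vec m)"
      using add[OF y e] scale[OF unit_vec_in_coord_space, of m "x m"] Suc.prems by simp
    also have "L y = (\<Sum>j<m. y j * L (unit_vec j))"
      using Suc.prems by (intro Suc.IH) (auto simp: y_def not_less_eq_eq le_Suc_eq)
    also have "\<dots> = (\<Sum>j<m. x j * L (unit_vec j))"
      by (intro sum.cong) (auto simp: y_def)
    finally show ?case by simp
  qed
  then show ?thesis using x by (simp add: vcarrier_coord_space)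
qed

text \<open>Here \<open>e\<close> is a basis and \<open>c\<close> its family of coordinate
  functionals; the third and fourth clauses make the coordinates a bijection of the carrier onto
  real n-space. The basis expansion is stated only after applying a functional \<open>l\<close>, so
  that finite sums are taken in the reals and never in terms of \<open>vadd V\<close>.\<close>

definition dual_basis :: "'a vs \<Rightarrow> nat \<Rightarrow> (nat \<Rightarrow> 'a) \<Rightarrow> (nat \<Rightarrow> 'a \<Rightarrow> real) \<Rightarrow> bool" where
  "dual_basis V n e c \<longleftrightarrow>
     (\<forall>j<n. e j \<in> vcarrier V) \<and> (\<forall>j<n. linear_map V scalars (c j)) \<and>
     (\<forall>a. \<exists>v\<in>vcarrier V. \<forall>j<n. c j v = a j) \<and>
     (\<forall>v\<in>vcarrier V. \<forall>w\<in>vcarrier V. (\<forall>j<n. c j v = c j w) \<longrightarrow> v = w) \<and>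
     (\<forall>l. linear_map V scalars l \<longrightarrow> (\<forall>v\<in>vcarrier V. l v = (\<Sum>j<n. c j v * l (e j))))"

lemma dual_basis_expand:
  assumes "dual_basis V n e c" "linear_map V scalars l" "v \<in> vcarrier V"
  shows "l v = (\<Sum>j<n. c j v * l (e j))"
  using assms unfolding dual_basis_def by blast

lemma dual_basis_in_carrier: "dual_basis V n e c \<Longrightarrow> j < n \<Longrightarrow> e j \<in> vcarrier V"
  by (simp add: dual_basis_def)

lemma linear_map_compose:
  "linear_map U V S \<Longrightarrow> linear_map V W T \<Longrightarrow> linear_map U W (\<lambda>x. T (S x))"
  by (simp add: linear_map_def)

lemma linear_functional_vzero:
  assumes "real_vector_space V" "linear_map V scalars l"
  shows "l (vzero V) = 0"
proof -
  have z: "vzero V \<in> vcarrier V" "vadd V (vzero V) (vzero V) = vzero V"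
    using assms(1) by (auto simp: real_vector_space_def)
  have "l (vadd V (vzero V) (vzero V)) = l (vzero V) + l (vzero V)"
    using assms(2) z(1) by (simp add: linear_map_def scalars_def)
  then show ?thesis unfolding z(2) by simp
qed

lemma has_vs_integral_cong:
  assumes "\<And>x. x \<in> space M \<Longrightarrow> f x = g x"
  shows "has_vs_integral V M f w \<longleftrightarrow> has_vs_integral V M g w"
proof -
  have "has_bochner_integral M (\<lambda>x. l (f x)) y \<longleftrightarrow> has_bochner_integral M (\<lambda>x. l (g x)) y"
    for l :: "_ \<Rightarrow> real" and y
    by (rule has_bochner_integral_cong) (simp_all add: assms)
  then show ?thesis by (simp add: has_vs_integral_def assms)
qed

text \<open>The coordinate functionals separate points. This is what gives the definite description
  in \<open>vs_integral\<close> a determined value.\<close>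

lemma has_vs_integral_unique:
  assumes "dual_basis V n e c" "has_vs_integral V M f v" "has_vs_integral V M f w"
  shows "v = w"
  using assms unfolding dual_basis_def has_vs_integral_def
  by (metis has_bochner_integral_eq)

lemma vs_integral_eqI:
  assumes "dual_basis V n e c" "has_vs_integral V M f w"
  shows "vs_integral V M f = w"
  unfolding vs_integral_def
  using assms by (blast intro: has_vs_integral_unique)

text \<open>The integral is the vector whose coordinates are the integrals of the coordinates of
  \<open>f\<close>. Every other functional is a finite linear combination of the coordinates, so
  linearity of the scalar integral settles it.\<close>

lemma vs_integrableI:
  assumes V: "dual_basis V n e c"
    and f: "\<And>x. x \<in> space M \<Longrightarrow> f x \<in> vcarrier V"
    and int: "\<And>l. linear_map V scalars l \<Longrightarrow> integrable M (\<lambda>x. l (f x))"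
  shows "vs_integrable V M f"
proof -
  have "\<exists>w\<in>vcarrier V. \<forall>j<n. c j w = a j" for a
    using V by (simp add: dual_basis_def)
  from this[of "\<lambda>j. \<integral>x. c j (f x) \<partial>M"] obtain w
    where w: "w \<in> vcarrier V" "\<And>j. j < n \<Longrightarrow> c j w = (\<integral>x. c j (f x) \<partial>M)"
    by auto
  have "has_bochner_integral M (\<lambda>x. l (f x)) (l w)" if l: "linear_map V scalars l" for l
  proof -
    note exp = dual_basis_expand[OF V l]
    have "has_bochner_integral M (\<lambda>x. c j (f x) * l (e j)) (c j w * l (e j))" if "j < n" for j
      using V that w(2) int
      by (intro has_bochner_integral_mult_left) (simp add: has_bochner_integral_iff dual_basis_def)
    then have "has_bochner_integral M (\<lambda>x. \<Sum>j<n. c j (f x) * l (e j)) (\<Sum>j<n. c j w * l (e j))"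
      by (intro has_bochner_integral_sum) auto
    also have "?this \<longleftrightarrow> ?thesis"
      by (intro has_bochner_integral_cong refl) (simp_all add: exp[OF f] exp[OF w(1)])
    finally show ?thesis .
  qed
  then show ?thesis
    using w f unfolding vs_integrable_def has_vs_integral_def by blast
qed

section \<open>Local trivializations\<close>

lemma vcarrier_fiber [simp]: "v \<in> vcarrier (fiber E b) \<longleftrightarrow> proj E v = b"
  by (simp add: fiber_def)

lemma local_trivialization_bij:
  assumes "local_trivialization E U n \<phi>"
  shows "bij_betw \<phi> (proj E -` U) (U \<times> topspace (Euclidean_space n))"
  using assms by (auto simp: local_trivialization_def bij_betw_def homeomorphic_eq_everything_map)

text \<open>Restriction is needed because \<open>hom_chart\<close> uses trivializations of both
  bundles over the same open set. A trivialization preserves base points, so it matches the part of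
  the total space over \<open>V\<close> with the part of the product over \<open>V\<close>.\<close>

lemma local_trivialization_subset:
  assumes \<phi>: "local_trivialization E U n \<phi>" and V: "open V" "V \<subseteq> U"
  shows "local_trivialization E V n \<phi>"
proof -
  have "homeomorphic_map (subtopology (top_of_set (proj E -` U)) (proj E -` V))
      (subtopology (prod_topology (top_of_set U) (Euclidean_space n)) (V \<times> UNIV)) \<phi>"
    using \<phi> by (intro homeomorphic_map_subtopologies_alt)
      (auto simp: local_trivialization_def mem_Times_iff)
  moreover have "proj E -` U \<inter> proj E -` V = proj E -` V" "U \<inter> V = V"
    using V by auto
  ultimately show ?thesis
    using \<phi> V by (auto simp: local_trivialization_def subtopology_Times subtopology_subtopology)
qed

text \<open>Over \<open>b\<close> the trivialization is a linear bijection onto the coordinate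
  space, and its inverse carries the standard basis into the fiber. The basis vectors are spelled
  exactly as in \<open>hom_chart\<close>, so that they produce the columns used there.\<close>

lemma dual_basis_local_trivialization:
  assumes V: "real_vector_space (fiber E b)" and \<phi>: "local_trivialization E U n \<phi>" and b: "b \<in> U"
  shows "dual_basis (fiber E b) n (\<lambda>j. inv_into (proj E -` U) \<phi> (b, unit_vec j))
           (\<lambda>j v. snd (\<phi> v) j)"
proof -
  note bij = local_trivialization_bij[OF \<phi>]
  define S where "S x = inv_into (proj E -` U) \<phi> (b, x)" for x
  have fst: "fst (\<phi> v) = proj E v" if "proj E v \<in> U" for v
    using \<phi> that by (auto simp: local_trivialization_def)
  have lin: "linear_map (fiber E b) (coord_space n) (\<lambda>v. snd (\<phi> v))"
    using \<phi> b by (auto simp: local_trivialization_def)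
  have \<phi>S: "\<phi> (S x) = (b, x)" and SU: "proj E (S x) \<in> U" if "x \<in> vcarrier (coord_space n)" for x
  proof -
    have "(b, x) \<in> U \<times> topspace (Euclidean_space n)"
      using that b by (simp add: coord_space_def)
    then have *: "(b, x) \<in> \<phi> ` (proj E -` U)"
      using bij by (simp add: bij_betw_def)
    show "\<phi> (S x) = (b, x)" unfolding S_def using * by (rule f_inv_into_f)
    show "proj E (S x) \<in> U" unfolding S_def using inv_into_into[OF *] by simp
  qed
  have proj_S: "proj E (S x) = b" if "x \<in> vcarrier (coord_space n)" for x
    using fst[OF SU[OF that]] \<phi>S[OF that] by simp
  have S\<phi>: "S (snd (\<phi> v)) = v" if "proj E v = b" for v
  proof -
    have "(b, snd (\<phi> v)) = \<phi> v" using fst[of v] that b by (metis prod.collapse)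
    then show ?thesis
      unfolding S_def using bij that b by (simp add: bij_betw_def)
  qed
  \<comment> \<open>The inverse inherits linearity: both sides of each identity lie in the fiber and
    have the same image under the trivialization, where \<open>S\<phi>\<close> recovers the vector
    from its image.\<close>
  have S_lin: "linear_map (coord_space n) (fiber E b) S"
    unfolding linear_map_def
  proof (intro conjI ballI allI)
    fix x assume x: "x \<in> vcarrier (coord_space n)"
    show "S x \<in> vcarrier (fiber E b)" using proj_S[OF x] by simp
    fix a
    have "vscale (fiber E b) a (S x) \<in> vcarrier (fiber E b)"
      using V proj_S[OF x] unfolding real_vector_space_def by simp
    moreover have "snd (\<phi> (vscale (fiber E b) a (S x))) = vscale (coord_space n) a x"
      using lin proj_S[OF x] \<phi>S[OF x] by (simp add: linear_map_def)
    ultimately show "S (vscale (coord_space n) a x) = vscale (fiber E b) a (S x)"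
      using S\<phi> by (metis vcarrier_fiber)
  next
    fix x y assume x: "x \<in> vcarrier (coord_space n)" and y: "y \<in> vcarrier (coord_space n)"
    have "vadd (fiber E b) (S x) (S y) \<in> vcarrier (fiber E b)"
      using V proj_S[OF x] proj_S[OF y] unfolding real_vector_space_def by simp
    moreover have "snd (\<phi> (vadd (fiber E b) (S x) (S y))) = vadd (coord_space n) x y"
      using lin proj_S[OF x] \<phi>S[OF x] proj_S[OF y] \<phi>S[OF y] by (simp add: linear_map_def)
    ultimately show "S (vadd (coord_space n) x y) = vadd (fiber E b) (S x) (S y)"
      using S\<phi> by (metis vcarrier_fiber)
  qed
  have coord: "snd (\<phi> v) \<in> vcarrier (coord_space n)" if "proj E v = b" for v
    using lin that by (simp add: linear_map_def)
  show ?thesis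
    unfolding dual_basis_def S_def[symmetric]
  proof (intro conjI allI impI ballI)
    fix j assume "j < n"
    show "S (unit_vec j) \<in> vcarrier (fiber E b)"
      using proj_S[OF unit_vec_in_coord_space[OF \<open>j < n\<close>]] by simp
    show "linear_map (fiber E b) scalars (\<lambda>v. snd (\<phi> v) j)"
      using lin by (auto simp: linear_map_def scalars_def coord_space_def)
  next
    fix a :: "nat \<Rightarrow> real"
    \<comment> \<open>The value 0 from index \<open>n\<close> on is forced, since
      \<open>coord_space n\<close> consists of sequences vanishing there.\<close>
    have a: "(\<lambda>i. if i < n then a i else 0) \<in> vcarrier (coord_space n)"
      by (simp add: vcarrier_coord_space)
    show "\<exists>v\<in>vcarrier (fiber E b). \<forall>j<n. snd (\<phi> v) j = a j"
      using \<phi>S[OF a] proj_S[OF a] by (intro bexI[of _ "S (\<lambda>i. if i < n then a i else 0)"]) auto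
  next
    fix v w assume vw: "v \<in> vcarrier (fiber E b)" "w \<in> vcarrier (fiber E b)"
      and eq: "\<forall>j<n. snd (\<phi> v) j = snd (\<phi> w) j"
    have "snd (\<phi> v) = snd (\<phi> w)"
      using coord[of v] coord[of w] vw eq
      by (intro ext) (metis vcarrier_coord_space vcarrier_fiber not_less)
    then show "v = w" using S\<phi> vw by (metis vcarrier_fiber)
  next
    fix l v assume l: "linear_map (fiber E b) scalars l" and v: "v \<in> vcarrier (fiber E b)"
    show "l v = (\<Sum>j<n. snd (\<phi> v) j * l (S (unit_vec j)))"
      using linear_functional_coord_space[OF linear_map_compose[OF S_lin l] coord, of v] v S\<phi>
      by simp
  qed
qed

lemma vector_bundle_dual_basis:
  assumes "vector_bundle E"
  obtains n e c where "dual_basis (fiber E b) n e c"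
  using assms dual_basis_local_trivialization unfolding vector_bundle_def by metis

lemma vector_bundle_common_trivialization:
  assumes "vector_bundle E" "vector_bundle F"
  obtains U n m \<phi> \<psi> where "b \<in> U" "local_trivialization E U n \<phi>" "local_trivialization F U m \<psi>"
proof -
  obtain U n \<phi> where U: "b \<in> U" "local_trivialization E U n \<phi>"
    using assms(1) unfolding vector_bundle_def by metis
  obtain U' m \<psi> where U': "b \<in> U'" "local_trivialization F U' m \<psi>"
    using assms(2) unfolding vector_bundle_def by metis
  have "open (U \<inter> U')" using U U' by (auto simp: local_trivialization_def)
  then show ?thesis
    using U U' that[of "U \<inter> U'" n \<phi> m \<psi>] by (auto intro: local_trivialization_subset)
qed

section \<open>Continuity of pairings\<close>

lemma continuous_map_Euclidean_space_component:
  "continuous_map (Euclidean_space n) euclideanreal (\<lambda>x. x i)"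
  unfolding Euclidean_space_def
  by (intro continuous_map_from_subtopology continuous_map_product_projection) simp

lemma continuous_on_trivialization_component:
  assumes \<phi>: "local_trivialization E U n \<phi>"
    and s: "continuous_on UNIV s" "\<And>x. proj E (s x) \<in> U"
  shows "continuous_on UNIV (\<lambda>x. snd (\<phi> (s x)) i)"
proof -
  have "continuous_map euclidean (top_of_set (proj E -` U)) s"
    using s by (auto simp: continuous_map_in_subtopology)
  moreover have "continuous_map (top_of_set (proj E -` U))
      (prod_topology (top_of_set U) (Euclidean_space n)) \<phi>"
    using \<phi> by (auto simp: local_trivialization_def homeomorphic_imp_continuous_map)
  ultimately have "continuous_map euclidean euclideanreal ((\<lambda>x. x i) \<circ> (snd \<circ> (\<phi> \<circ> s)))"
    by (intro continuous_map_compose[OF _ continuous_map_Euclidean_space_component]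
        continuous_map_compose[OF _ continuous_map_snd] continuous_map_compose[of _ _ s])
  then show ?thesis by (simp add: o_def)
qed

text \<open>The topology on the Hom bundle is generated by preimages of open sets under the charts,
  so every chart is continuous along \<open>T\<close>. A matrix entry is the chart followed by two
  coordinate projections.\<close>

lemma continuous_on_matrix_entry:
  assumes E: "vector_bundle E"
    and \<phi>: "local_trivialization E U n \<phi>" and \<psi>: "local_trivialization F U m \<psi>" and b: "b \<in> U"
    and hom: "\<And>h. (b, T h) \<in> hom_total E F"
    and cont: "continuous_map euclidean (hom_topology E F) (\<lambda>h. (b, T h))"
    and j: "j < n"
  shows "continuous_on UNIV (\<lambda>h. snd (\<psi> (T h (inv_into (proj E -` U) \<phi> (b, unit_vec j)))) i)"
proof -
  let ?e = "\<lambda>j. inv_into (proj E -` U) \<phi> (b, unit_vec j)"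
  let ?P = "product_topology (\<lambda>_. Euclidean_space m) {..<n}"
  let ?H = "\<lambda>h. hom_chart E U n \<phi> \<psi> (b, T h)"
  have "dual_basis (fiber E b) n ?e (\<lambda>j v. snd (\<phi> v) j)"
    using E \<phi> b by (intro dual_basis_local_trivialization) (auto simp: vector_bundle_def)
  then have e: "proj E (?e j) = b" if "j < n" for j
    using that unfolding dual_basis_def by simp
  have T: "proj F (T h v) = b" if "proj E v = b" for h v
    using hom[of h] that by (auto simp: hom_total_def linear_map_def)
  have col: "snd (\<psi> v) \<in> topspace (Euclidean_space m)" if "proj F v = b" for v
    using \<psi> b that by (auto simp: local_trivialization_def linear_map_def coord_space_def)
  have "continuous_map euclidean (prod_topology (top_of_set U) ?P) ?H"
    unfolding continuous_map_def
  proof (intro conjI allI impI)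
    show "?H \<in> topspace euclidean \<rightarrow> topspace (prod_topology (top_of_set U) ?P)"
      using b by (auto simp: hom_chart_def intro!: col T e)
    fix W assume W: "openin (prod_topology (top_of_set U) ?P) W"
    \<comment> \<open>This preimage under the chart is itself one of the generating sets.\<close>
    have "openin (hom_topology E F)
        {x \<in> hom_total E F. fst x \<in> U \<and> hom_chart E U n \<phi> \<psi> x \<in> W}"
      unfolding hom_topology_def using \<phi> \<psi> W by (intro topology_generated_by_Basis) blast
    from openin_continuous_map_preimage[OF cont this]
    show "openin euclidean {h \<in> topspace euclidean. ?H h \<in> W}"
      using hom b by simp
  qed
  then have "continuous_map euclidean ?P (snd \<circ> ?H)"
    by (rule continuous_map_compose[OF _ continuous_map_snd])
  moreover have "continuous_map ?P (Euclidean_space m) (\<lambda>x. x j)"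
    using j by (intro continuous_map_product_projection) simp
  ultimately have "continuous_map euclidean (Euclidean_space m) ((\<lambda>x. x j) \<circ> (snd \<circ> ?H))"
    by (rule continuous_map_compose)
  then have "continuous_map euclidean euclideanreal ((\<lambda>x. x i) \<circ> ((\<lambda>x. x j) \<circ> (snd \<circ> ?H)))"
    by (rule continuous_map_compose[OF _ continuous_map_Euclidean_space_component])
  then show ?thesis using j by (simp add: o_def hom_chart_def)
qed

text \<open>Expanding \<open>s h\<close> in a basis of the fiber of \<open>E\<close>, and then each
  column of \<open>T h\<close> in a basis of the fiber of \<open>F\<close>, turns the pairing into a
  finite sum of products of real functions whose continuity is already known.\<close>

lemma continuous_on_pairing:
  assumes E: "vector_bundle E" and F: "vector_bundle F"
    and hom: "\<And>h. (b, T h) \<in> hom_total E F"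
    and cont: "continuous_map euclidean (hom_topology E F) (\<lambda>h. (b, T h))"
    and s: "continuous_on UNIV s" "\<And>h. proj E (s h) = b"
    and l: "linear_map (fiber F b) scalars l"
  shows "continuous_on UNIV (\<lambda>h. l (T h (s h)))"
proof -
  obtain U n m \<phi> \<psi> where b: "b \<in> U"
    and \<phi>: "local_trivialization E U n \<phi>" and \<psi>: "local_trivialization F U m \<psi>"
    by (rule vector_bundle_common_trivialization[OF E F])
  let ?e = "\<lambda>j. inv_into (proj E -` U) \<phi> (b, unit_vec j)"
  let ?d = "\<lambda>i. inv_into (proj F -` U) \<psi> (b, unit_vec i)"
  have dE: "dual_basis (fiber E b) n ?e (\<lambda>j v. snd (\<phi> v) j)"
    using E \<phi> b by (intro dual_basis_local_trivialization) (auto simp: vector_bundle_def)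
  have dF: "dual_basis (fiber F b) m ?d (\<lambda>j v. snd (\<psi> v) j)"
    using F \<psi> b by (intro dual_basis_local_trivialization) (auto simp: vector_bundle_def)
  have T: "linear_map (fiber E b) (fiber F b) (T h)" for h
    using hom[of h] by (simp add: hom_total_def)
  have "l (T h (s h)) = (\<Sum>j<n. snd (\<phi> (s h)) j * (\<Sum>i<m. snd (\<psi> (T h (?e j))) i * l (?d i)))" for h
  proof -
    have "l (T h (s h)) = (\<Sum>j<n. snd (\<phi> (s h)) j * l (T h (?e j)))"
      by (rule dual_basis_expand[OF dE linear_map_compose[OF T l]]) (simp add: s(2))
    moreover have "l (T h (?e j)) = (\<Sum>i<m. snd (\<psi> (T h (?e j))) i * l (?d i))" if "j < n" for j
    proof (rule dual_basis_expand[OF dF l])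
      have "?e j \<in> vcarrier (fiber E b)"
        using dual_basis_in_carrier[OF dE that] .
      then show "T h (?e j) \<in> vcarrier (fiber F b)"
        using T[of h] unfolding linear_map_def by blast
    qed
    ultimately show ?thesis by simp
  qed
  moreover have "continuous_on UNIV
      (\<lambda>h. \<Sum>j<n. snd (\<phi> (s h)) j * (\<Sum>i<m. snd (\<psi> (T h (?e j))) i * l (?d i)))"
  proof (intro continuous_on_sum continuous_on_mult continuous_on_const)
    show "continuous_on UNIV (\<lambda>h. snd (\<phi> (s h)) j)" for j
      by (rule continuous_on_trivialization_component[OF \<phi> s(1)]) (simp add: b s(2))
    show "continuous_on UNIV (\<lambda>h. snd (\<psi> (T h (?e j))) i)" if "j \<in> {..<n}" for i j
      by (rule continuous_on_matrix_entry[OF E \<phi> \<psi> b hom cont]) (use that in simp)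
  qed
  ultimately show ?thesis by simp
qed

section \<open>Integrability\<close>

text \<open>Closedness of \<open>S\<close> makes \<open>K \<inter> S\<close> compact, so finitely
  many open sets with traces of finite measure cover it.\<close>

lemma emeasure_compact_finite:
  fixes M :: "'x::t2_space measure"
  assumes M: "locally_finite_borel_on S M" and S: "closed S" and K: "compact K"
  shows "K \<inter> S \<in> sets M" "emeasure M (K \<inter> S) < \<infinity>"
proof -
  have sets: "A \<inter> S \<in> sets M" if "A \<in> sets borel" for A
    using M S that by (auto simp: locally_finite_borel_on_def sets_restrict_space)
  then show "K \<inter> S \<in> sets M" using K by (simp add: compact_imp_closed borel_closed)
  have "compact (K \<inter> S)" using K S by (rule compact_Int_closed)
  moreover have "\<forall>x\<in>S. \<exists>U. open U \<and> x \<in> U \<and> emeasure M (U \<inter> S) < \<infinity>"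
    using M by (simp add: locally_finite_borel_on_def)
  then obtain U where U: "\<And>x. x \<in> S \<Longrightarrow> open (U x) \<and> x \<in> U x \<and> emeasure M (U x \<inter> S) < \<infinity>"
    by metis
  ultimately obtain D where D: "D \<subseteq> S" "finite D" "K \<inter> S \<subseteq> (\<Union>x\<in>D. U x)"
    by (elim compactE_image[where C = S and f = U]) (use U in blast)+
  have US: "U x \<inter> S \<in> sets M" if "x \<in> D" for x
    using D(1) U that by (intro sets) auto
  have "emeasure M (K \<inter> S) \<le> emeasure M (\<Union>x\<in>D. U x \<inter> S)"
    using D(2,3) US by (intro emeasure_mono sets.finite_UN) auto
  also have "\<dots> \<le> (\<Sum>x\<in>D. emeasure M (U x \<inter> S))"
    using D(2) US by (intro emeasure_subadditive_finite) auto
  also have "\<dots> < \<infinity>"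
    using D U by (auto simp: less_top)
  finally show "emeasure M (K \<inter> S) < \<infinity>" .
qed

lemma space_locally_finite_borel_on:
  assumes "locally_finite_borel_on S M"
  shows "space M = S"
  using assms sets_eq_imp_space_eq[of M "restrict_space borel S"]
  by (simp add: locally_finite_borel_on_def space_restrict_space)

text \<open>The function is bounded on its compact support, whose trace on \<open>S\<close> has
  finite measure. The lemma serves both the whole group and the stabilizer.\<close>

lemma integrable_compactly_supported:
  fixes M :: "'x::t2_space measure" and f :: "'x \<Rightarrow> real"
  assumes M: "locally_finite_borel_on S M" and S: "closed S"
    and f: "continuous_on UNIV f" "compactly_supported f"
  shows "integrable M f"
proof -
  define K where "K = closure {x. f x \<noteq> 0}"
  have K: "compact K" using f(2) by (simp add: compactly_supported_def K_def)
  have zero: "f x = 0" if "x \<notin> K" for x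
    using that closure_subset[of "{x. f x \<noteq> 0}"] by (auto simp: K_def)
  have "bounded (f ` K)"
    using K f(1) by (intro compact_imp_bounded compact_continuous_image)
      (auto intro: continuous_on_subset)
  then obtain B where B: "\<And>x. x \<in> K \<Longrightarrow> norm (f x) \<le> B"
    by (auto simp: bounded_iff)
  have "f \<in> borel_measurable (restrict_space borel S)"
    using f(1) by (intro measurable_restrict_space1 borel_measurable_continuous_onI)
  then have meas: "f \<in> borel_measurable M"
    using M by (simp add: locally_finite_borel_on_def cong: measurable_cong_sets)
  note fin = emeasure_compact_finite[OF M S K]
  show ?thesis
    using B zero space_locally_finite_borel_on[OF M]
    by (intro integrableI_bounded_set[OF fin(1) meas fin(2), of B] AE_I2) auto
qed

lemma compactly_supported_subset:
  fixes f :: "'x::t2_space \<Rightarrow> real"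
  assumes "compact (closure A)" "{x. f x \<noteq> 0} \<subseteq> A"
  shows "compactly_supported f"
  unfolding compactly_supported_def
  using compact_Int_closed[OF assms(1) closed_closure[of "{x. f x \<noteq> 0}"]]
    closure_mono[OF assms(2)] by (simp add: Int_absorb1)

text \<open>The support moves by left translation with \<open>- k\<close>, which is continuous and
  so preserves compactness.\<close>

lemma compactly_supported_translation:
  fixes f :: "'g::{topological_group_add, t2_space} \<Rightarrow> real"
  assumes "compactly_supported f"
  shows "compactly_supported (\<lambda>h. f (k + h))"
proof -
  let ?C = "(\<lambda>h. - k + h) ` closure {x. f x \<noteq> 0}"
  have C: "compact ?C"
    using assms unfolding compactly_supported_def
    by (intro compact_continuous_image continuous_intros)
  have "{h. f (k + h) \<noteq> 0} \<subseteq> ?C"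
  proof
    fix h assume "h \<in> {h. f (k + h) \<noteq> 0}"
    then have "k + h \<in> closure {x. f x \<noteq> 0}" by (intro closure_subset[THEN subsetD]) simp
    moreover have "h = - k + (k + h)" by (simp flip: add.assoc)
    ultimately show "h \<in> ?C" by blast
  qed
  then show ?thesis
    using C by (intro compactly_supported_subset[of ?C])
      (simp_all add: compact_imp_closed)
qed

lemma continuous_action_on:
  assumes "continuous_action act" "continuous_on S p" "continuous_on S q"
  shows "continuous_on S (\<lambda>x. act (p x) (q x))"
proof -
  have "continuous_on UNIV (\<lambda>(g, x). act g x)"
    using assms(1) by (simp add: continuous_action_def)
  from continuous_on_compose2[OF this continuous_on_Pair[OF assms(2,3)]]
  show ?thesis by simp
qed

text \<open>The stabilizer is the preimage of the closed point \<open>b\<close> under the orbit map.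
  Closedness allows integration of compactly supported functions against the measures
  \<open>nu b\<close>.\<close>

lemma closed_stab:
  fixes act :: "'g::topological_group_add \<Rightarrow> 'b::t2_space \<Rightarrow> 'b"
  assumes "continuous_action act"
  shows "closed (stab act b)"
proof -
  have "continuous_on UNIV (\<lambda>g. act g b)"
    by (rule continuous_action_on[OF assms continuous_on_id continuous_on_const])
  then have "closed ((\<lambda>g. act g b) -` {b})"
    by (intro closed_vimage) auto
  then show ?thesis by (simp add: stab_def vimage_def)
qed

section \<open>The integral transform\<close>

text \<open>The integrability conjuncts give the equation its content, because
  \<open>vs_integral\<close> is a definite description and is meaningful only where an integral
  exists.\<close>

theorem theorem4p3:
  fixes act :: "'g::{topological_group_add, t2_space} \<Rightarrow> 'b::t2_space \<Rightarrow> 'b"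
    and E :: "('b, 'e::topological_space) vbundle" and actE :: "'g \<Rightarrow> 'e \<Rightarrow> 'e"
    and F :: "('b, 'f::topological_space) vbundle" and actF :: "'g \<Rightarrow> 'f \<Rightarrow> 'f"
    and mu :: "'b \<Rightarrow> 'g measure" and mub :: "'b \<Rightarrow> 'b measure" and nu :: "'b \<Rightarrow> 'g measure"
    and \<omega> :: "'g \<Rightarrow> 'b \<Rightarrow> 'e \<Rightarrow> 'f" and \<kappa> :: "'b \<Rightarrow> 'b \<Rightarrow> 'e \<Rightarrow> 'f"
    and f :: "'b \<Rightarrow> 'e" and b :: 'b
  assumes "continuous_action act"
    and "equivariant_bundle act E actE"
    and "equivariant_bundle act F actF"
    and "orbit_measures act mu mub nu"
    and "equivariant_filter act E actE F actF \<omega>"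
    and "\<kappa> = orbit_kernel act actE F nu \<omega>"
    and "continuous_section E f"
  shows "(\<forall>k. vs_integrable (fiber F b) (nu b)
            (\<lambda>h. \<omega> (k + h) b (actE (- h + - k) (f (act k b))))) \<and>
         vs_integrable (fiber F b) (mub b) (\<lambda>c. \<kappa> c b (f c)) \<and>
         vs_integrable (fiber F b) (mu b) (\<lambda>k. \<omega> k b (mackey_section act actE f (0 + k) b)) \<and>
         orbit_transform F mub \<kappa> f b =
           cross_correlation F mu \<omega> (mackey_section act actE f) 0 b"
proof -
  note act = assms(1) and meas = assms(4)
  have E: "vector_bundle E" and actE: "continuous_action actE" and F: "vector_bundle F"
    using assms(2,3) by (auto simp: equivariant_bundle_def)
  have act_minus: "act (- h) (act h x) = x" for h x
    using act unfolding continuous_action_def by (metis left_minus)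
  \<comment> \<open>This is the Mackey section with its second argument fixed at \<open>b\<close>.
    All its values lie in the single fiber over \<open>b\<close>, so only two fixed
    finite-dimensional spaces are involved from here on.\<close>
  define s where "s = (\<lambda>k. actE (- k) (f (act k b)))"
  define \<Phi> where "\<Phi> = (\<lambda>k. \<omega> k b (s k))"
  have s_fiber: "proj E (s k) = b" for k
    using assms(2,7) act_minus by (simp add: s_def equivariant_bundle_def continuous_section_def)
  have f: "continuous_on UNIV f" using assms(7) by (simp add: continuous_section_def)
  have minus: "continuous_on UNIV (\<lambda>k::'g. - k)" by (intro continuous_intros)
  have s_cont: "continuous_on UNIV s"
    unfolding s_def
    by (rule continuous_action_on[OF actE minus continuous_on_compose2[OF f
          continuous_action_on[OF act continuous_on_id continuous_on_const] subset_UNIV]])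
  have hom: "(b, \<omega> h b) \<in> hom_total E F" for h
    using assms(5) by (simp add: equivariant_filter_def)
  have "continuous_map euclidean euclidean (\<lambda>h::'g. (h, b))"
    by (simp add: continuous_on_Pair)
  moreover have "continuous_map euclidean (hom_topology E F) (\<lambda>(h, b). (b, \<omega> h b))"
    using assms(5) by (simp add: equivariant_filter_def)
  ultimately have "continuous_map euclidean (hom_topology E F) ((\<lambda>(h, b). (b, \<omega> h b)) \<circ> (\<lambda>h. (h, b)))"
    by (rule continuous_map_compose)
  then have cont: "continuous_map euclidean (hom_topology E F) (\<lambda>h. (b, \<omega> h b))"
    by (simp add: o_def)
  have \<Phi>_fiber: "proj F (\<Phi> k) = b" for k
    using hom[of k] s_fiber by (simp add: \<Phi>_def hom_total_def linear_map_def)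
  have l\<Phi>_cont: "continuous_on UNIV (\<lambda>k. l (\<Phi> k))"
    if "linear_map (fiber F b) scalars l" for l
    unfolding \<Phi>_def by (rule continuous_on_pairing[OF E F hom cont s_cont s_fiber that])
  \<comment> \<open>A functional kills the zero vector, so the pairing vanishes wherever the filter
    at \<open>b\<close> is the zero map, whatever the section does.\<close>
  have l\<Phi>_supp: "compactly_supported (\<lambda>k. l (\<Phi> k))"
    if l: "linear_map (fiber F b) scalars l" for l
  proof (rule compactly_supported_subset)
    show "compact (closure {h. \<exists>v\<in>proj E -` {b}. \<omega> h b v \<noteq> bzero F b})"
      using assms(5) by (simp add: equivariant_filter_def)
    have "l (bzero F b) = 0"
      using linear_functional_vzero[OF _ l] F by (simp add: vector_bundle_def fiber_def)
    then have "\<omega> k b (s k) \<noteq> bzero F b" if "l (\<Phi> k) \<noteq> 0" for k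
      using that by (auto simp: \<Phi>_def)
    moreover have "s k \<in> proj E -` {b}" for k
      using s_fiber by simp
    ultimately show "{k. l (\<Phi> k) \<noteq> 0} \<subseteq> {h. \<exists>v\<in>proj E -` {b}. \<omega> h b v \<noteq> bzero F b}"
      by blast
  qed
  obtain n e c where dual: "dual_basis (fiber F b) n e c"
    by (rule vector_bundle_dual_basis[OF F])
  have mu: "locally_finite_borel_on UNIV (mu b)"
    and mub: "locally_finite_borel_on (orbit act b) (mub b)"
    and nu: "locally_finite_borel_on (stab act b) (nu b)"
    using meas by (simp_all add: orbit_measures_def)

  have int_mu: "vs_integrable (fiber F b) (mu b) \<Phi>"
    by (rule vs_integrableI[OF dual])
      (simp_all add: \<Phi>_fiber integrable_compactly_supported[OF mu closed_UNIV l\<Phi>_cont l\<Phi>_supp])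
  then obtain w where w: "has_vs_integral (fiber F b) (mu b) \<Phi> w"
    by (auto simp: vs_integrable_def)
  have int_nu: "vs_integrable (fiber F b) (nu b) (\<lambda>h. \<Phi> (k + h))" for k
  proof (rule vs_integrableI[OF dual])
    show "\<Phi> (k + h) \<in> vcarrier (fiber F b)" for h by (simp add: \<Phi>_fiber)
    fix l assume l: "linear_map (fiber F b) scalars l"
    have "continuous_on UNIV (\<lambda>h. k + h)" by (intro continuous_intros)
    from continuous_on_compose2[OF l\<Phi>_cont[OF l] this subset_UNIV]
    show "integrable (nu b) (\<lambda>h. l (\<Phi> (k + h)))"
      by (rule integrable_compactly_supported[OF nu closed_stab[OF act] _
            compactly_supported_translation[OF l\<Phi>_supp[OF l]]])
  qed
  \<comment> \<open>For \<open>h\<close> in the stabilizer, \<open>k + h\<close> and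
    \<open>k\<close> move \<open>b\<close> to the same point, and \<open>- h + - k\<close> is the
    inverse of \<open>k + h\<close>. Agreement on the stabilizer is enough, as it is the space of
    \<open>nu b\<close>.\<close>
  have \<Phi>_stab: "\<omega> (k + h) b (actE (- h + - k) (f (act k b))) = \<Phi> (k + h)"
    if "h \<in> stab act b" for k h
  proof -
    have "act (k + h) b = act k b"
      using act that by (simp add: continuous_action_def stab_def)
    then show ?thesis by (simp add: \<Phi>_def s_def minus_add)
  qed
  have has_nu_cong: "has_vs_integral (fiber F b) (nu b)
        (\<lambda>h. \<omega> (k + h) b (actE (- h + - k) (f (act k b)))) v \<longleftrightarrow>
      has_vs_integral (fiber F b) (nu b) (\<lambda>h. \<Phi> (k + h)) v" for k v
    by (intro has_vs_integral_cong \<Phi>_stab) (simp only: space_locally_finite_borel_on[OF nu])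
  have int1: "vs_integrable (fiber F b) (nu b)
        (\<lambda>h. \<omega> (k + h) b (actE (- h + - k) (f (act k b))))" for k
    using int_nu[of k] unfolding vs_integrable_def has_nu_cong .
  \<comment> \<open>The kernel and the decomposition in \<open>orbit_measures\<close> use the same
    \<open>transporter act b c\<close>, so the kernel value can be inserted directly as the inner
    integral.\<close>
  have kernel: "has_vs_integral (fiber F b) (nu b) (\<lambda>h. \<Phi> (transporter act b c + h)) (\<kappa> c b (f c))"
    if "c \<in> orbit act b" for c
  proof -
    define k where "k = transporter act b c"
    have c: "act k b = c"
      using that act_transporter[of act b] by (auto simp: orbit_def k_def)
    obtain v where v: "has_vs_integral (fiber F b) (nu b) (\<lambda>h. \<Phi> (k + h)) v"
      using int_nu[of k] by (auto simp: vs_integrable_def)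
    then have "has_vs_integral (fiber F b) (nu b)
        (\<lambda>h. \<omega> (k + h) b (actE (- h + - k) (f c))) v"
      using has_nu_cong[of k v] unfolding c by (rule iffD2[rotated])
    from vs_integral_eqI[OF dual this] have "\<kappa> c b (f c) = v"
      unfolding assms(6) orbit_kernel_def Let_def k_def .
    then show ?thesis using v unfolding k_def by simp
  qed
  \<comment> \<open>The integral \<open>w\<close> over the group is shown to be the integral over
    the orbit as well, by testing against each functional \<open>l\<close>.\<close>
  have w_mub: "has_vs_integral (fiber F b) (mub b) (\<lambda>c. \<kappa> c b (f c)) w"
    unfolding has_vs_integral_def
  proof (intro conjI ballI allI impI)
    show "w \<in> vcarrier (fiber F b)" using w by (simp add: has_vs_integral_def)
    show "\<kappa> c b (f c) \<in> vcarrier (fiber F b)" if "c \<in> space (mub b)" for c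
      using kernel[of c] that space_locally_finite_borel_on[OF mub]
      by (simp add: has_vs_integral_def)
    fix l assume l: "linear_map (fiber F b) scalars l"
    \<comment> \<open>The orbit is not assumed closed, so integrability over it comes from the
      decomposition hypothesis, applied to the compactly supported function
      \<open>l (\<Phi> h)\<close>, and not from a compactness argument on the orbit.\<close>
    have "has_bochner_integral (mub b)
        (\<lambda>c. \<integral>h. l (\<Phi> (transporter act b c + h)) \<partial>nu b) (\<integral>h. l (\<Phi> h) \<partial>mu b)"
      using meas l\<Phi>_cont[OF l] l\<Phi>_supp[OF l] unfolding orbit_measures_def by blast
    also have "?this \<longleftrightarrow> has_bochner_integral (mub b) (\<lambda>c. l (\<kappa> c b (f c))) (l w)"
    proof (intro has_bochner_integral_cong refl)
      show "(\<integral>h. l (\<Phi> h) \<partial>mu b) = l w"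
        using w l by (auto simp: has_vs_integral_def intro: has_bochner_integral_integral_eq)
      show "(\<integral>h. l (\<Phi> (transporter act b c + h)) \<partial>nu b) = l (\<kappa> c b (f c))"
        if "c \<in> space (mub b)" for c
        using kernel[of c] that l space_locally_finite_borel_on[OF mub]
        by (auto simp: has_vs_integral_def intro: has_bochner_integral_integral_eq)
    qed
    finally show "has_bochner_integral (mub b) (\<lambda>c. l (\<kappa> c b (f c))) (l w)" .
  qed
  then have int_mub: "vs_integrable (fiber F b) (mub b) (\<lambda>c. \<kappa> c b (f c))"
    by (auto simp: vs_integrable_def)
  have \<Phi>_mackey: "(\<lambda>k. \<omega> k b (mackey_section act actE f (0 + k) b)) = \<Phi>"
    by (simp add: \<Phi>_def s_def mackey_section_def)
  have "orbit_transform F mub \<kappa> f b = w"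
    unfolding orbit_transform_def by (rule vs_integral_eqI[OF dual w_mub])
  moreover have "cross_correlation F mu \<omega> (mackey_section act actE f) 0 b = w"
    unfolding cross_correlation_def \<Phi>_mackey by (rule vs_integral_eqI[OF dual w])
  ultimately show ?thesis
    using int1 int_mu int_mub unfolding \<Phi>_mackey by (simp only: simp_thms)
qed

end
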